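(* Let $n\ge 1$ and let $g$ be the Semi-Riemannian metric on $GL_n=GL_n(\mathbb{R})$ given by $g_A(V,W)=\mathrm{tr}(A^{-1}VA^{-1}W)$ for $A\in GL_n$, $V,W\in T_A(GL_n)=M_n(\mathbb{R})$. Let $K\in GL_n$ and $X,Y,Z,W\in M_n(\mathbb{R})=T_K(GL_n)$. 1) The Riemann curvature tensor of type $(1,3)$ of $(GL_n,g)$ at $K$ is $$(R_{XY}Z)_K=-\tfrac14\left(Z\,[K^{-1}X,K^{-1}Y]-[XK^{-1},YK^{-1}]\,Z\right).$$ 2) The Riemann curvature tensor of type $(0,4)$ of $(GL_n,g)$ at $K$ is $$R_{XYZW}(K)=\tfrac14\,\mathrm{tr}\left([K^{-1}X,K^{-1}Y]\,[K^{-1}Z,K^{-1}W]\right).$$ 3) If $s_K$ is a nondegenerate $2$-section of $T_K(GL_n)$ (i.e. a $2$-dimensional subspace of $T_K(GL_n)=M_n(\mathbb{R})$ such that the restriction of $g_K$ to $s_K\times s_K$ is a nondegenerate symmetric bilinear form) and $X,Y$ are linearly independent vectors in $s_K$, then the sectional curvature of $(GL_n,g)$ on $s_K$ is $$\mathcal{K}(s_K)=\frac14\,\frac{\mathrm{tr}\left([K^{-1}X,K^{-1}Y]^2\right)}{g_K(X,X)g_K(Y,Y)-g_K(X,Y)^2}.$$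
   Context: $[A,B]=AB-BA$ for matrices $A,B$. Curvature sign conventions (those of O'Neill): with $\nabla$ the Levi-Civita connection, $R_{XY}Z=\nabla_{[X,Y]}Z-\nabla_X\nabla_YZ+\nabla_Y\nabla_XZ$ for vector fields $X,Y,Z$; $R_{XYZW}=g(R_{XY}Z,W)$; and the sectional curvature of a nondegenerate plane spanned by $X,Y$ is $\frac{R_{XYXY}}{g(X,X)g(Y,Y)-g(X,Y)^2}$. *)

theory Defs
  imports "HOL-Analysis.Analysis"
begin

section \<open>Semi-Riemannian geometry of an open subset of a Euclidean space\<close>

text \<open>
  The manifold is an open set \<open>U\<close> of a Euclidean space, regarded as covered by one global chart:
  every tangent space is the ambient vector space, vector fields on \<open>U\<close> are smooth functions from
  \<open>U\<close> to it, and a metric assigns a bilinear form to each point. Functions are total in HOL; their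
  values outside \<open>U\<close> carry no information.
\<close>

primrec Ck_on :: "nat \<Rightarrow> 'a::euclidean_space set \<Rightarrow> ('a \<Rightarrow> 'b::real_normed_vector) \<Rightarrow> bool" where
  "Ck_on 0 U f \<longleftrightarrow> continuous_on U f"
| "Ck_on (Suc k) U f \<longleftrightarrow>
     (\<forall>p\<in>U. f differentiable (at p)) \<and> (\<forall>v. Ck_on k U (\<lambda>p. frechet_derivative f (at p) v))"

definition smooth_on :: "'a::euclidean_space set \<Rightarrow> ('a \<Rightarrow> 'b::real_normed_vector) \<Rightarrow> bool" where
  "smooth_on U f \<longleftrightarrow> (\<forall>k. Ck_on k U f)"

abbreviation vector_field :: "'a::euclidean_space set \<Rightarrow> ('a \<Rightarrow> 'a) \<Rightarrow> bool" where
  "vector_field U X \<equiv> smooth_on U X"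

definition dir_deriv :: "('a::euclidean_space \<Rightarrow> 'a) \<Rightarrow> ('a \<Rightarrow> 'b::real_normed_vector) \<Rightarrow> 'a \<Rightarrow> 'b" where
  "dir_deriv X f p = frechet_derivative f (at p) (X p)"

text \<open>
  As derivations, \<open>[X,Y]f = X(Yf) - Y(Xf)\<close>; in the global chart the second derivatives of \<open>f\<close> cancel
  and the components of the bracket are \<open>X(Y\<^sup>i) - Y(X\<^sup>i)\<close>.
\<close>
definition lie_bracket :: "('a::euclidean_space \<Rightarrow> 'a) \<Rightarrow> ('a \<Rightarrow> 'a) \<Rightarrow> 'a \<Rightarrow> 'a" where
  "lie_bracket X Y p = dir_deriv X Y p - dir_deriv Y X p"

definition index_form :: "('a::euclidean_space \<Rightarrow> 'a \<Rightarrow> real) \<Rightarrow> nat" where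
  "index_form b = Max (dim ` {S. subspace S \<and> (\<forall>v\<in>S. v \<noteq> 0 \<longrightarrow> b v v < 0)})"

definition nondegenerate_on :: "'a::euclidean_space set \<Rightarrow> ('a \<Rightarrow> 'a \<Rightarrow> real) \<Rightarrow> bool" where
  "nondegenerate_on S b \<longleftrightarrow> (\<forall>v\<in>S. (\<forall>w\<in>S. b v w = 0) \<longrightarrow> v = 0)"

definition semi_riemannian_metric ::
    "'a::euclidean_space set \<Rightarrow> ('a \<Rightarrow> 'a \<Rightarrow> 'a \<Rightarrow> real) \<Rightarrow> bool" where
  "semi_riemannian_metric U g \<longleftrightarrow>
     open U
   \<and> (\<forall>p\<in>U. bilinear (g p) \<and> (\<forall>v w. g p v w = g p w v) \<and> nondegenerate_on UNIV (g p))
   \<and> (\<forall>v w. smooth_on U (\<lambda>p. g p v w))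
   \<and> (\<exists>\<nu>. \<forall>p\<in>U. index_form (g p) = \<nu>)"

text \<open>\<open>D X Y\<close> is the covariant derivative of \<open>Y\<close> along \<open>X\<close>.\<close>

definition affine_connection ::
    "'a::euclidean_space set \<Rightarrow> (('a \<Rightarrow> 'a) \<Rightarrow> ('a \<Rightarrow> 'a) \<Rightarrow> 'a \<Rightarrow> 'a) \<Rightarrow> bool" where
  "affine_connection U D \<longleftrightarrow>
     (\<forall>X Y. vector_field U X \<longrightarrow> vector_field U Y \<longrightarrow> vector_field U (D X Y))
   \<and> (\<forall>X X' Y. vector_field U X \<longrightarrow> vector_field U X' \<longrightarrow> vector_field U Y \<longrightarrow>
        (\<forall>p\<in>U. D (\<lambda>q. X q + X' q) Y p = D X Y p + D X' Y p))
   \<and> (\<forall>f X Y. smooth_on U f \<longrightarrow> vector_field U X \<longrightarrow> vector_field U Y \<longrightarrow>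
        (\<forall>p\<in>U. D (\<lambda>q. f q *\<^sub>R X q) Y p = f p *\<^sub>R D X Y p))
   \<and> (\<forall>X Y Y'. vector_field U X \<longrightarrow> vector_field U Y \<longrightarrow> vector_field U Y' \<longrightarrow>
        (\<forall>p\<in>U. D X (\<lambda>q. Y q + Y' q) p = D X Y p + D X Y' p))
   \<and> (\<forall>f X Y. smooth_on U f \<longrightarrow> vector_field U X \<longrightarrow> vector_field U Y \<longrightarrow>
        (\<forall>p\<in>U. D X (\<lambda>q. f q *\<^sub>R Y q) p = dir_deriv X f p *\<^sub>R Y p + f p *\<^sub>R D X Y p))"

definition is_levi_civita ::
    "'a::euclidean_space set \<Rightarrow> ('a \<Rightarrow> 'a \<Rightarrow> 'a \<Rightarrow> real) \<Rightarrow>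
     (('a \<Rightarrow> 'a) \<Rightarrow> ('a \<Rightarrow> 'a) \<Rightarrow> 'a \<Rightarrow> 'a) \<Rightarrow> bool" where
  "is_levi_civita U g D \<longleftrightarrow>
     semi_riemannian_metric U g \<and> affine_connection U D
   \<and> (\<forall>X Y. vector_field U X \<longrightarrow> vector_field U Y \<longrightarrow>
        (\<forall>p\<in>U. lie_bracket X Y p = D X Y p - D Y X p))
   \<and> (\<forall>X Y Z. vector_field U X \<longrightarrow> vector_field U Y \<longrightarrow> vector_field U Z \<longrightarrow>
        (\<forall>p\<in>U. dir_deriv X (\<lambda>q. g q (Y q) (Z q)) p = g p (D X Y p) (Z p) + g p (Y p) (D X Z p)))"

text \<open>
  The Levi-Civita connection is unique on smooth fields and at points of \<open>U\<close>. A choice operator is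
  used instead of a definite description only because \<open>D X Y p\<close> is unconstrained when \<open>X\<close> or \<open>Y\<close> is
  not smooth on \<open>U\<close> or \<open>p \<notin> U\<close>; no such value enters the curvature.
\<close>
definition levi_civita ::
    "'a::euclidean_space set \<Rightarrow> ('a \<Rightarrow> 'a \<Rightarrow> 'a \<Rightarrow> real) \<Rightarrow> ('a \<Rightarrow> 'a) \<Rightarrow> ('a \<Rightarrow> 'a) \<Rightarrow> 'a \<Rightarrow> 'a" where
  "levi_civita U g = (SOME D. is_levi_civita U g D)"

text \<open>O'Neill's sign convention; many texts use the opposite sign.\<close>
definition curvature ::
    "(('a::euclidean_space \<Rightarrow> 'a) \<Rightarrow> ('a \<Rightarrow> 'a) \<Rightarrow> 'a \<Rightarrow> 'a) \<Rightarrow>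
     ('a \<Rightarrow> 'a) \<Rightarrow> ('a \<Rightarrow> 'a) \<Rightarrow> ('a \<Rightarrow> 'a) \<Rightarrow> 'a \<Rightarrow> 'a" where
  "curvature D X Y Z p = D (lie_bracket X Y) Z p - D X (D Y Z) p + D Y (D X Z) p"

text \<open>
  The value at \<open>p\<close> on tangent vectors is the common value on all vector fields extending them.
\<close>
definition riemann13 ::
    "'a::euclidean_space set \<Rightarrow> ('a \<Rightarrow> 'a \<Rightarrow> 'a \<Rightarrow> real) \<Rightarrow> 'a \<Rightarrow> 'a \<Rightarrow> 'a \<Rightarrow> 'a \<Rightarrow> 'a" where
  "riemann13 U g p x y z =
     (THE w. \<forall>X Y Z. vector_field U X \<longrightarrow> vector_field U Y \<longrightarrow> vector_field U Z \<longrightarrow>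
        X p = x \<longrightarrow> Y p = y \<longrightarrow> Z p = z \<longrightarrow> curvature (levi_civita U g) X Y Z p = w)"

definition riemann04 ::
    "'a::euclidean_space set \<Rightarrow> ('a \<Rightarrow> 'a \<Rightarrow> 'a \<Rightarrow> real) \<Rightarrow> 'a \<Rightarrow> 'a \<Rightarrow> 'a \<Rightarrow> 'a \<Rightarrow> 'a \<Rightarrow> real" where
  "riemann04 U g p x y z w = g p (riemann13 U g p x y z) w"

definition nondegenerate_section ::
    "('a::euclidean_space \<Rightarrow> 'a \<Rightarrow> 'a \<Rightarrow> real) \<Rightarrow> 'a \<Rightarrow> 'a set \<Rightarrow> bool" where
  "nondegenerate_section g p S \<longleftrightarrow> subspace S \<and> dim S = 2 \<and> nondegenerate_on S (g p)"

text \<open>The inequality \<open>x \<noteq> y\<close> is needed because \<open>{x, x}\<close> is a singleton set.\<close>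
definition lin_indep2 :: "'a::real_vector \<Rightarrow> 'a \<Rightarrow> bool" where
  "lin_indep2 x y \<longleftrightarrow> x \<noteq> y \<and> independent {x, y}"

text \<open>The common value over all bases of the plane \<open>S\<close>.\<close>
definition sectional_curvature ::
    "'a::euclidean_space set \<Rightarrow> ('a \<Rightarrow> 'a \<Rightarrow> 'a \<Rightarrow> real) \<Rightarrow> 'a \<Rightarrow> 'a set \<Rightarrow> real" where
  "sectional_curvature U g p S =
     (THE k. \<forall>x\<in>S. \<forall>y\<in>S. lin_indep2 x y \<longrightarrow>
        riemann04 U g p x y x y / (g p x x * g p y y - (g p x y)\<^sup>2) = k)"

section \<open>The general linear group\<close>

definition GL :: "(real ^ 'n ^ 'n) set" where
  "GL = {A. invertible A}"

definition gl_metric :: "real ^ 'n ^ 'n \<Rightarrow> real ^ 'n ^ 'n \<Rightarrow> real ^ 'n ^ 'n \<Rightarrow> real" where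
  "gl_metric A V W = trace (matrix_inv A ** V ** matrix_inv A ** W)"

definition commutator :: "real ^ 'n ^ 'n \<Rightarrow> real ^ 'n ^ 'n \<Rightarrow> real ^ 'n ^ 'n" where
  "commutator A B = A ** B - B ** A"

end

theory Submission
  imports Defs
begin

text \<open>
  The Levi-Civita connection of the trace metric is
  \<open>D X Y = dY(X) - (X p\<^sup>-\<^sup>1 Y + Y p\<^sup>-\<^sup>1 X) / 2\<close> at \<open>p\<close>: it is visibly torsion-free, and metric
  compatibility is the derivative \<open>- p\<^sup>-\<^sup>1 H p\<^sup>-\<^sup>1\<close> of the inverse together with the cyclicity of
  the trace. Since the Levi-Civita connection is unique, the curvature may be computed from this
  formula; the second derivatives of \<open>Z\<close> cancel by Schwarz's theorem, the first derivatives of all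
  three fields cancel algebraically, and the quadratic terms leave the commutators. The
  \<open>(0,4)\<close> tensor follows by cyclicity of the trace.
\<close>

section \<open>Smooth functions on open sets\<close>

lemma frechet_derivativeI:
  "(f has_derivative f') (at p) \<Longrightarrow> frechet_derivative f (at p) = f'"
  by (metis frechet_derivative_at)

text \<open>At a point of an open set, differentiability and the derivative depend only on nearby
  values. Agreement on \<open>U\<close> therefore passes to the directional derivatives, and the
  induction continues with these.\<close>

lemma Ck_on_cong:
  assumes "open U" "\<And>q. q \<in> U \<Longrightarrow> f q = g q"
  shows "Ck_on k U f \<longleftrightarrow> Ck_on k U g"
  using assms(2)
proof (induction k arbitrary: f g)
  case 0
  then show ?case by (auto intro: continuous_on_cong)
next
  case (Suc k)
  have diff: "f differentiable (at p) \<longleftrightarrow> g differentiable (at p)" if "p \<in> U" for p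
    using Suc.prems that \<open>open U\<close> unfolding differentiable_def
    by (metis has_derivative_transform_within_open)
  have "Ck_on k U (\<lambda>p. frechet_derivative f (at p) v) \<longleftrightarrow>
        Ck_on k U (\<lambda>p. frechet_derivative g (at p) v)"
    if "\<forall>p\<in>U. f differentiable (at p)" for v
  proof (rule Suc.IH)
    fix p assume "p \<in> U"
    with that Suc.prems \<open>open U\<close>
    have "frechet_derivative f (at p) = frechet_derivative g (at p)"
      by (intro frechet_derivative_transform_within_open[where X=U]) auto
    then show "frechet_derivative f (at p) v = frechet_derivative g (at p) v" by simp
  qed
  then show ?case using diff by auto
qed

text \<open>Lets a derivative known in closed form on \<open>U\<close> stand in for
  \<open>frechet_derivative\<close>, whose values off \<open>U\<close> are not controlled.\<close>

lemma Ck_on_SucI: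
  assumes "open U" "\<And>p. p \<in> U \<Longrightarrow> (f has_derivative f' p) (at p)"
    "\<And>v. Ck_on k U (\<lambda>p. f' p v)"
  shows "Ck_on (Suc k) U f"
proof -
  have "Ck_on k U (\<lambda>p. frechet_derivative f (at p) v)" for v
    using Ck_on_cong[OF assms(1), of "\<lambda>p. frechet_derivative f (at p) v" "\<lambda>p. f' p v" k]
      frechet_derivativeI[OF assms(2)] assms(3) by simp
  then show ?thesis using assms(2) by (auto simp: differentiable_def)
qed

lemma Ck_on_SucD:
  assumes "Ck_on (Suc k) U f" "p \<in> U"
  shows "(f has_derivative frechet_derivative f (at p)) (at p)"
  using assms by (simp add: frechet_derivative_works[symmetric])

lemma Ck_on_Suc_imp: "Ck_on (Suc k) U f \<Longrightarrow> Ck_on k U f"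
proof (induction k arbitrary: f)
  case 0
  then show ?case
    by (auto intro: continuous_at_imp_continuous_on differentiable_imp_continuous_within)
next
  case (Suc k)
  then show ?case by (metis Ck_on.simps(2))
qed

lemma Ck_on_const: "Ck_on k U (\<lambda>p. c)"
  by (induction k arbitrary: c) auto

lemma Ck_on_bounded_linear:
  assumes "bounded_linear L" "open U" "Ck_on k U f"
  shows "Ck_on k U (\<lambda>p. L (f p))"
  using assms(3)
proof (induction k arbitrary: f)
  case 0
  then show ?case by (simp add: bounded_linear.continuous_on[OF assms(1)])
next
  case (Suc k)
  show ?case
    by (rule Ck_on_SucI[OF \<open>open U\<close> bounded_linear.has_derivative[OF assms(1) Ck_on_SucD[OF Suc.prems]]])
      (use Suc in auto)
qed

lemma Ck_on_add:
  assumes "open U" "Ck_on k U f" "Ck_on k U g"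
  shows "Ck_on k U (\<lambda>p. f p + g p)"
  using assms(2,3)
proof (induction k arbitrary: f g)
  case 0
  then show ?case by (simp add: continuous_on_add)
next
  case (Suc k)
  show ?case
    by (rule Ck_on_SucI[OF \<open>open U\<close>
          has_derivative_add[OF Ck_on_SucD[OF Suc.prems(1)] Ck_on_SucD[OF Suc.prems(2)]]])
      (use Suc in auto)
qed

text \<open>The product rule leaves one factor undifferentiated in each summand. Lowering that
  factor from order \<open>Suc k\<close> to order \<open>k\<close> makes the induction hypothesis
  applicable to both summands.\<close>

lemma Ck_on_bounded_bilinear:
  assumes "bounded_bilinear m" "open U" "Ck_on k U f" "Ck_on k U g"
  shows "Ck_on k U (\<lambda>p. m (f p) (g p))"
  using assms(3,4)
proof (induction k arbitrary: f g)
  case 0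
  then show ?case by (simp add: bounded_bilinear.continuous_on[OF assms(1)])
next
  case (Suc k)
  note fg = Suc.prems[THEN Ck_on_Suc_imp]
  have D: "Ck_on k U (\<lambda>p. frechet_derivative f (at p) v)"
    "Ck_on k U (\<lambda>p. frechet_derivative g (at p) v)" for v
    using Suc.prems by simp_all
  show ?case
    by (rule Ck_on_SucI[OF \<open>open U\<close> bounded_bilinear.FDERIV[OF assms(1)
            Ck_on_SucD[OF Suc.prems(1)] Ck_on_SucD[OF Suc.prems(2)]]])
      (assumption | intro Ck_on_add[OF \<open>open U\<close>] Suc.IH fg D)+
qed

lemma smooth_on_cong:
  "open U \<Longrightarrow> (\<And>q. q \<in> U \<Longrightarrow> f q = g q) \<Longrightarrow> smooth_on U f \<longleftrightarrow> smooth_on U g"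
  unfolding smooth_on_def using Ck_on_cong by blast

lemma smooth_on_has_derivative:
  "smooth_on U f \<Longrightarrow> p \<in> U \<Longrightarrow> (f has_derivative frechet_derivative f (at p)) (at p)"
  unfolding smooth_on_def by (blast intro: Ck_on_SucD)

lemma smooth_on_frechet_derivative:
  "smooth_on U f \<Longrightarrow> smooth_on U (\<lambda>p. frechet_derivative f (at p) v)"
  unfolding smooth_on_def by (metis Ck_on.simps(2))

lemma smooth_on_const: "smooth_on U (\<lambda>p. c)"
  by (simp add: smooth_on_def Ck_on_const)

lemma smooth_on_bounded_linear:
  "bounded_linear L \<Longrightarrow> open U \<Longrightarrow> smooth_on U f \<Longrightarrow> smooth_on U (\<lambda>p. L (f p))"
  by (simp add: smooth_on_def Ck_on_bounded_linear)

lemma smooth_on_bounded_bilinear: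
  "bounded_bilinear m \<Longrightarrow> open U \<Longrightarrow> smooth_on U f \<Longrightarrow> smooth_on U g
    \<Longrightarrow> smooth_on U (\<lambda>p. m (f p) (g p))"
  by (simp add: smooth_on_def Ck_on_bounded_bilinear)

lemma smooth_on_add:
  "open U \<Longrightarrow> smooth_on U f \<Longrightarrow> smooth_on U g \<Longrightarrow> smooth_on U (\<lambda>p. f p + g p)"
  by (simp add: smooth_on_def Ck_on_add)

lemmas smooth_on_scaleR = smooth_on_bounded_bilinear[OF bounded_bilinear_scaleR]
lemmas smooth_on_scaleR_const = smooth_on_bounded_linear[OF bounded_linear_scaleR_right]

lemma smooth_on_diff:
  assumes "open U" "smooth_on U f" "smooth_on U g"
  shows "smooth_on U (\<lambda>p. f p - g p)"
  using smooth_on_add[OF assms(1,2) smooth_on_scaleR_const[OF assms(1,3), of "-1"]] by simp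

lemma smooth_on_sum:
  assumes "open U" "\<And>i. i \<in> I \<Longrightarrow> smooth_on U (f i)"
  shows "smooth_on U (\<lambda>p. \<Sum>i\<in>I. f i p)"
  using assms(2)
  by (induction I rule: infinite_finite_induct)
    (auto simp: smooth_on_const intro!: smooth_on_add[OF \<open>open U\<close>])

text \<open>\<open>Ck_on\<close> speaks only of derivatives in fixed directions. This expansion
  turns a direction that moves with the point into scalar coefficients times such
  derivatives.\<close>

lemma frechet_derivative_Basis_expansion:
  fixes f :: "'a::euclidean_space \<Rightarrow> 'b::real_normed_vector"
  assumes "f differentiable (at p)"
  shows "frechet_derivative f (at p) v = (\<Sum>b\<in>Basis. (v \<bullet> b) *\<^sub>R frechet_derivative f (at p) b)"
proof -
  interpret linear "frechet_derivative f (at p)"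
    using assms by (rule linear_frechet_derivative)
  have "frechet_derivative f (at p) v = frechet_derivative f (at p) (\<Sum>b\<in>Basis. (v \<bullet> b) *\<^sub>R b)"
    by (simp add: euclidean_representation)
  then show ?thesis by (simp add: sum scale)
qed

lemma smooth_on_differentiable: "smooth_on U f \<Longrightarrow> p \<in> U \<Longrightarrow> f differentiable (at p)"
  using smooth_on_has_derivative differentiable_def by blast

lemma smooth_on_dir_deriv:
  assumes "open U" "smooth_on U X" "smooth_on U f"
  shows "smooth_on U (dir_deriv X f)"
proof -
  have "smooth_on U (\<lambda>p. \<Sum>b\<in>Basis. (X p \<bullet> b) *\<^sub>R frechet_derivative f (at p) b)"
    using assms
    by (intro smooth_on_sum smooth_on_scaleR smooth_on_frechet_derivative
        smooth_on_bounded_linear[OF bounded_linear_inner_left])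
  moreover have "dir_deriv X f p = (\<Sum>b\<in>Basis. (X p \<bullet> b) *\<^sub>R frechet_derivative f (at p) b)"
    if "p \<in> U" for p
    unfolding dir_deriv_def
    using assms(3) that by (intro frechet_derivative_Basis_expansion smooth_on_differentiable)
  ultimately show ?thesis by (simp add: smooth_on_cong[OF \<open>open U\<close>, of "dir_deriv X f"])
qed

lemma smooth_on_lie_bracket:
  assumes "open U" "smooth_on U X" "smooth_on U Y"
  shows "smooth_on U (lie_bracket X Y)"
  using smooth_on_diff[OF assms(1) smooth_on_dir_deriv[OF assms(1-3)] smooth_on_dir_deriv[OF assms(1,3,2)]]
  by (simp add: lie_bracket_def[abs_def])

section \<open>Symmetry of second derivatives\<close>

text \<open>Two applications of the mean value theorem: first along \<open>u\<close> to the
  increment of \<open>f\<close> in the direction \<open>v\<close>, then along \<open>v\<close> to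
  the derivative of \<open>f\<close> in the direction \<open>u\<close>. The size condition on
  \<open>h\<close> keeps the whole parallelogram inside the ball.\<close>

lemma mixed_difference:
  fixes f :: "'a::euclidean_space \<Rightarrow> real"
  assumes "ball p r \<subseteq> U" "Ck_on 2 U f" "h > 0" "h * (norm u + norm v) < r"
  shows "\<exists>q\<in>ball p r. f (p + h *\<^sub>R u + h *\<^sub>R v) - f (p + h *\<^sub>R u) - (f (p + h *\<^sub>R v) - f p)
    = h * h * frechet_derivative (\<lambda>q. frechet_derivative f (at q) u) (at q) v"
proof -
  have mem: "p + s *\<^sub>R u + t *\<^sub>R v \<in> ball p r" if "0 \<le> s" "s \<le> h" "0 \<le> t" "t \<le> h" for s t
  proof -
    have "norm (s *\<^sub>R u + t *\<^sub>R v) \<le> s * norm u + t * norm v"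
      using that norm_triangle_ineq[of "s *\<^sub>R u" "t *\<^sub>R v"] by simp
    also have "\<dots> \<le> h * norm u + h * norm v"
      using that by (intro add_mono mult_right_mono) auto
    also have "\<dots> < r" using assms(4) by (simp add: algebra_simps)
    finally show ?thesis
      by (simp add: dist_norm norm_minus_commute algebra_simps)
  qed
  let ?D = "\<lambda>q. frechet_derivative f (at q)"
  have C1: "Ck_on (Suc (Suc 0)) U f" using assms(2) by (simp add: numeral_2_eq_2)
  then have C2: "Ck_on (Suc 0) U (\<lambda>q. ?D q u)" by (metis Ck_on.simps(2))
  have chain: "((\<lambda>s. F (a + s *\<^sub>R w)) has_field_derivative F' w) (at s)"
    if F: "(F has_derivative F') (at (a + s *\<^sub>R w))" for F :: "'a \<Rightarrow> real" and F' a s w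
  proof -
    have "((\<lambda>s. F (a + s *\<^sub>R w)) has_derivative (\<lambda>t. F' (t *\<^sub>R w))) (at s)"
      by (rule has_derivative_compose[where f="\<lambda>s. a + s *\<^sub>R w" and g=F, OF _ F])
        (auto intro!: derivative_eq_intros)
    moreover have "F' (t *\<^sub>R w) = F' w * t" for t
      using linear_scale[OF has_derivative_linear[OF F]] by simp
    ultimately show ?thesis by (simp add: has_field_derivative_def)
  qed
  define \<phi> where "\<phi> s = f (p + h *\<^sub>R v + s *\<^sub>R u) - f (p + s *\<^sub>R u)" for s
  have \<phi>: "(\<phi> has_field_derivative ?D (p + h *\<^sub>R v + s *\<^sub>R u) u - ?D (p + s *\<^sub>R u) u) (at s)"
    if "0 \<le> s" "s \<le> h" for s
    unfolding \<phi>_def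
    using mem[of s h] mem[of s 0] that assms(1,3)
    by (intro DERIV_diff chain Ck_on_SucD[OF C1]) (auto simp: algebra_simps)
  obtain s where s: "0 < s" "s < h"
    "\<phi> h - \<phi> 0 = (h - 0) * (?D (p + h *\<^sub>R v + s *\<^sub>R u) u - ?D (p + s *\<^sub>R u) u)"
    using MVT2[OF assms(3) \<phi>] by auto
  define \<psi> where "\<psi> t = ?D (p + s *\<^sub>R u + t *\<^sub>R v) u" for t
  have \<psi>: "(\<psi> has_field_derivative frechet_derivative (\<lambda>q. ?D q u) (at (p + s *\<^sub>R u + t *\<^sub>R v)) v) (at t)"
    if "0 \<le> t" "t \<le> h" for t
    unfolding \<psi>_def
    using mem[of s t] that s assms(1) by (intro chain Ck_on_SucD[OF C2]) auto
  obtain t where t: "0 < t" "t < h"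
    "\<psi> h - \<psi> 0 = (h - 0) * frechet_derivative (\<lambda>q. ?D q u) (at (p + s *\<^sub>R u + t *\<^sub>R v)) v"
    using MVT2[OF assms(3) \<psi>] by auto
  have "\<psi> h - \<psi> 0 = ?D (p + h *\<^sub>R v + s *\<^sub>R u) u - ?D (p + s *\<^sub>R u) u"
    by (simp add: \<psi>_def add_ac)
  with s(3) t(3) have "\<phi> h - \<phi> 0 = h * h * frechet_derivative (\<lambda>q. ?D q u) (at (p + s *\<^sub>R u + t *\<^sub>R v)) v"
    by simp
  moreover have "\<phi> h - \<phi> 0 = f (p + h *\<^sub>R u + h *\<^sub>R v) - f (p + h *\<^sub>R u) - (f (p + h *\<^sub>R v) - f p)"
    by (simp add: \<phi>_def add_ac)
  ultimately show ?thesis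
    using mem[of s t] s t by (metis less_imp_le)
qed

text \<open>The mixed difference is symmetric in \<open>u\<close> and \<open>v\<close>, so the
  second derivatives in the two orders take one common value at two points close to
  \<open>p\<close>. Continuity then excludes a gap at \<open>p\<close>.\<close>

lemma symmetric_second_derivative_real:
  fixes f :: "'a::euclidean_space \<Rightarrow> real"
  assumes "open U" "Ck_on 2 U f" "p \<in> U"
  shows "frechet_derivative (\<lambda>q. frechet_derivative f (at q) u) (at p) v =
         frechet_derivative (\<lambda>q. frechet_derivative f (at q) v) (at p) u"
    (is "?G p = ?H p")
proof (rule ccontr)
  assume neq: "?G p \<noteq> ?H p"
  \<comment> \<open>Half the gap: a common value within \<open>e\<close> of both \<open>?G p\<close>
    and \<open>?H p\<close> contradicts the triangle inequality.\<close>
  define e where "e = dist (?G p) (?H p) / 2"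
  have "e > 0" using neq by (simp add: e_def)
  have "continuous_on U ?G" "continuous_on U ?H"
    using assms(2) by (simp_all add: numeral_2_eq_2)
  then have cont: "isCont ?G p" "isCont ?H p"
    using assms(1,3) by (auto simp: continuous_on_eq_continuous_at)
  obtain d1 where d1: "d1 > 0" "\<And>q. dist q p < d1 \<Longrightarrow> dist (?G q) (?G p) < e"
    using cont(1) \<open>e > 0\<close> unfolding continuous_at_eps_delta by blast
  obtain d2 where d2: "d2 > 0" "\<And>q. dist q p < d2 \<Longrightarrow> dist (?H q) (?H p) < e"
    using cont(2) \<open>e > 0\<close> unfolding continuous_at_eps_delta by blast
  note d = d1(1) d2(1) d1(2) d2(2)
  obtain d3 where d3: "d3 > 0" "ball p d3 \<subseteq> U" using assms(1,3) openE by blast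
  define r where "r = min d3 (min d1 d2)"
  \<comment> \<open>The parallelogram with sides \<open>h *\<^sub>R u\<close> and
    \<open>h *\<^sub>R v\<close> fits into the ball of radius \<open>r\<close>; the summand 1 keeps
    the denominator positive even when both vectors vanish.\<close>
  define h where "h = r / (2 * (norm u + norm v + 1))"
  have r: "r > 0" using d d3 by (simp add: r_def)
  have pos: "norm u + norm v + 1 > 0" using norm_ge_zero[of u] norm_ge_zero[of v] by linarith
  with r have h: "h > 0" by (simp add: h_def)
  have "norm u + norm v < 2 * (norm u + norm v + 1)" using pos by (simp add: field_simps)
  then have "h * (norm u + norm v) < h * (2 * (norm u + norm v + 1))"
    using h by (rule mult_strict_left_mono)
  then have hr: "h * (norm u + norm v) < r" "h * (norm v + norm u) < r"
    using pos by (simp_all add: h_def add.commute)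
  have U: "ball p r \<subseteq> U" using d3 by (auto simp: r_def)
  obtain q where q: "q \<in> ball p r"
    "f (p + h *\<^sub>R u + h *\<^sub>R v) - f (p + h *\<^sub>R u) - (f (p + h *\<^sub>R v) - f p) = h * h * ?G q"
    using mixed_difference[OF U assms(2) h hr(1)] by blast
  obtain q' where q': "q' \<in> ball p r"
    "f (p + h *\<^sub>R v + h *\<^sub>R u) - f (p + h *\<^sub>R v) - (f (p + h *\<^sub>R u) - f p) = h * h * ?H q'"
    using mixed_difference[OF U assms(2) h hr(2)] by blast
  have "h * h * ?G q = h * h * ?H q'" unfolding q(2)[symmetric] q'(2)[symmetric] by (simp add: add_ac)
  then have eq: "?G q = ?H q'" using h by simp
  have "dist (?G q) (?G p) < e"
    using q(1) d(3)[of q] by (simp add: r_def dist_commute)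
  moreover have "dist (?G q) (?H p) < e"
    unfolding eq using q'(1) d(4)[of q'] by (simp add: r_def dist_commute)
  ultimately have "dist (?G q) (?G p) + dist (?G q) (?H p) < e + e"
    by (rule add_strict_mono)
  also have "\<dots> = dist (?G p) (?H p)" by (simp add: e_def)
  also have "\<dots> \<le> dist (?G q) (?G p) + dist (?G q) (?H p)" by (rule dist_triangle3)
  finally show False by simp
qed

text \<open>Pairing with each basis vector reduces to the real case, since the inner product with a
  fixed vector commutes with both differentiations.\<close>

lemma symmetric_second_derivative:
  fixes f :: "'a::euclidean_space \<Rightarrow> 'b::euclidean_space"
  assumes "open U" "smooth_on U f" "p \<in> U"
  shows "frechet_derivative (\<lambda>q. frechet_derivative f (at q) u) (at p) v =
         frechet_derivative (\<lambda>q. frechet_derivative f (at q) v) (at p) u"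
proof (rule euclidean_eqI)
  fix b :: 'b
  let ?f = "\<lambda>q. f q \<bullet> b"
  have eq: "frechet_derivative (\<lambda>q. F q \<bullet> b) (at q) w = frechet_derivative F (at q) w \<bullet> b"
    if "smooth_on U F" "q \<in> U" for F :: "'a \<Rightarrow> 'b" and q w
    using frechet_derivativeI[OF bounded_linear.has_derivative[OF bounded_linear_inner_left
          smooth_on_has_derivative[OF that]]] by simp
  have snd: "frechet_derivative (\<lambda>q. frechet_derivative ?f (at q) w) (at p) w' =
      frechet_derivative (\<lambda>q. frechet_derivative f (at q) w) (at p) w' \<bullet> b" for w w'
  proof -
    have s: "smooth_on U ?f"
      by (rule smooth_on_bounded_linear[OF bounded_linear_inner_left assms(1,2)])
    have "frechet_derivative (\<lambda>q. frechet_derivative ?f (at q) w) (at p) =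
      frechet_derivative (\<lambda>q. frechet_derivative f (at q) w \<bullet> b) (at p)"
      using assms eq[OF assms(2)] smooth_on_frechet_derivative[OF s]
      by (intro frechet_derivative_transform_within_open[where X=U])
        (auto intro: smooth_on_differentiable)
    then show ?thesis
      using eq[OF smooth_on_frechet_derivative[OF assms(2)] assms(3)] by simp
  qed
  have "Ck_on 2 U ?f"
    using smooth_on_bounded_linear[OF bounded_linear_inner_left assms(1,2)]
    by (simp add: smooth_on_def)
  from symmetric_second_derivative_real[OF assms(1) this assms(3), of u v]
  show "frechet_derivative (\<lambda>q. frechet_derivative f (at q) u) (at p) v \<bullet> b =
      frechet_derivative (\<lambda>q. frechet_derivative f (at q) v) (at p) u \<bullet> b"
    unfolding snd .
qed

text \<open>The point and the direction both move: one summand differentiates again with the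
  direction frozen at \<open>X p\<close>, the other differentiates the direction. Expanding over
  \<open>Basis\<close> reduces this to the product rule for scalars times fixed-direction
  derivatives.\<close>

lemma has_derivative_dir_deriv:
  fixes f :: "'a::euclidean_space \<Rightarrow> 'b::real_normed_vector"
  assumes "smooth_on U f" "(X has_derivative X') (at p)" "open U" "p \<in> U"
  shows "(dir_deriv X f has_derivative (\<lambda>h.
     frechet_derivative (\<lambda>q. frechet_derivative f (at q) (X p)) (at p) h
     + frechet_derivative f (at p) (X' h))) (at p)"
proof -
  let ?D = "\<lambda>q. frechet_derivative f (at q)"
  note s = smooth_on_frechet_derivative[OF assms(1)]
  let ?D2 = "\<lambda>b. frechet_derivative (\<lambda>q. ?D q b) (at p)"
  have expand: "?D q v = (\<Sum>b\<in>Basis. (v \<bullet> b) *\<^sub>R ?D q b)" if "q \<in> U" for q v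
    by (rule frechet_derivative_Basis_expansion[OF smooth_on_differentiable[OF assms(1) that]])
  have D2: "((\<lambda>q. ?D q v) has_derivative (\<lambda>h. \<Sum>b\<in>Basis. (v \<bullet> b) *\<^sub>R ?D2 b h)) (at p)" for v
  proof -
    have "((\<lambda>q. \<Sum>b\<in>Basis. (v \<bullet> b) *\<^sub>R ?D q b) has_derivative (\<lambda>h. \<Sum>b\<in>Basis. (v \<bullet> b) *\<^sub>R ?D2 b h)) (at p)"
      by (intro has_derivative_sum has_derivative_scaleR_right smooth_on_has_derivative[OF s assms(4)])
    then show ?thesis
      by (rule has_derivative_transform_within_open[OF _ assms(3,4)]) (metis expand)
  qed
  have "((\<lambda>q. \<Sum>b\<in>Basis. (X q \<bullet> b) *\<^sub>R ?D q b) has_derivative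
     (\<lambda>h. \<Sum>b\<in>Basis. (X p \<bullet> b) *\<^sub>R ?D2 b h + (X' h \<bullet> b) *\<^sub>R ?D p b)) (at p)"
    by (intro has_derivative_sum has_derivative_scaleR smooth_on_has_derivative[OF s assms(4)]
        has_derivative_inner_left assms(2))
  then have "(dir_deriv X f has_derivative
     (\<lambda>h. \<Sum>b\<in>Basis. (X p \<bullet> b) *\<^sub>R ?D2 b h + (X' h \<bullet> b) *\<^sub>R ?D p b)) (at p)"
    by (rule has_derivative_transform_within_open[OF _ assms(3,4)])
       (unfold dir_deriv_def, metis expand)
  moreover have "?D2 (X p) h + ?D p (X' h)
      = (\<Sum>b\<in>Basis. (X p \<bullet> b) *\<^sub>R ?D2 b h + (X' h \<bullet> b) *\<^sub>R ?D p b)" for h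
    using expand[OF assms(4), of "X' h"] frechet_derivativeI[OF D2[of "X p"]]
    by (simp add: sum.distrib)
  ultimately show ?thesis by simp
qed

section \<open>Uniqueness of the Levi-Civita connection\<close>

lemma affine_connectionD:
  assumes "affine_connection U D" "smooth_on U X" "smooth_on U Y"
  shows affine_connection_smooth: "smooth_on U (D X Y)"
    and affine_connection_add:
      "smooth_on U Y' \<Longrightarrow> p \<in> U \<Longrightarrow> D X (\<lambda>q. Y q + Y' q) p = D X Y p + D X Y' p"
    and affine_connection_scaleR:
      "smooth_on U f \<Longrightarrow> p \<in> U \<Longrightarrow>
        D X (\<lambda>q. f q *\<^sub>R Y q) p = dir_deriv X f p *\<^sub>R Y p + f p *\<^sub>R D X Y p"
proof -
  note D = assms(1)[unfolded affine_connection_def]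
  show "smooth_on U (D X Y)"
    by (rule D[THEN conjunct1, rule_format]) fact+
  show "D X (\<lambda>q. Y q + Y' q) p = D X Y p + D X Y' p" if "smooth_on U Y'" "p \<in> U"
    by (rule D[THEN conjunct2, THEN conjunct2, THEN conjunct2, THEN conjunct1, rule_format]) fact+
  show "D X (\<lambda>q. f q *\<^sub>R Y q) p = dir_deriv X f p *\<^sub>R Y p + f p *\<^sub>R D X Y p"
    if "smooth_on U f" "p \<in> U"
    by (rule D[THEN conjunct2, THEN conjunct2, THEN conjunct2, THEN conjunct2, rule_format]) fact+
qed

lemma is_levi_civitaD:
  assumes "is_levi_civita U g D"
  shows levi_civita_metric: "semi_riemannian_metric U g"
    and levi_civita_affine: "affine_connection U D"
    and levi_civita_torsion_free: "smooth_on U X \<Longrightarrow> smooth_on U Y \<Longrightarrow> p \<in> U \<Longrightarrow>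
      lie_bracket X Y p = D X Y p - D Y X p"
    and levi_civita_compatible: "smooth_on U X \<Longrightarrow> smooth_on U Y \<Longrightarrow> smooth_on U Z \<Longrightarrow> p \<in> U \<Longrightarrow>
      dir_deriv X (\<lambda>q. g q (Y q) (Z q)) p = g p (D X Y p) (Z p) + g p (Y p) (D X Z p)"
proof -
  note D = assms[unfolded is_levi_civita_def]
  show "semi_riemannian_metric U g" "affine_connection U D" using D by simp_all
  show "lie_bracket X Y p = D X Y p - D Y X p"
    if "smooth_on U X" "smooth_on U Y" "p \<in> U"
    by (rule D[THEN conjunct2, THEN conjunct2, THEN conjunct1, rule_format]) fact+
  show "dir_deriv X (\<lambda>q. g q (Y q) (Z q)) p = g p (D X Y p) (Z p) + g p (Y p) (D X Z p)"
    if "smooth_on U X" "smooth_on U Y" "smooth_on U Z" "p \<in> U"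
    by (rule D[THEN conjunct2, THEN conjunct2, THEN conjunct2, rule_format]) fact+
qed

text \<open>
  Locality needs no bump functions: the extension by 1 outside \<open>U\<close> of the zero function is smooth
  on \<open>U\<close> in the sense of \<open>smooth_on\<close>, and scaling the difference of the two fields by it
  leaves that difference unchanged.
\<close>

lemma affine_connection_cong:
  assumes D: "affine_connection U D" and "open U"
    and X: "smooth_on U X" and V: "smooth_on U V" "smooth_on U V'"
    and eq: "\<And>q. q \<in> U \<Longrightarrow> V q = V' q" and p: "p \<in> U"
  shows "D X V p = D X V' p"
proof -
  define f :: "'a \<Rightarrow> real" where "f q = (if q \<in> U then 0 else 1)" for q
  define W where "W q = V q - V' q" for q
  have f: "smooth_on U f"
    using smooth_on_cong[OF \<open>open U\<close>, of f "\<lambda>q. 0"] by (simp add: f_def smooth_on_const)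
  have W: "smooth_on U W"
    unfolding W_def by (rule smooth_on_diff[OF \<open>open U\<close> V])
  have fW: "smooth_on U (\<lambda>q. f q *\<^sub>R W q)"
    by (rule smooth_on_scaleR[OF \<open>open U\<close> f W])
  have "V = (\<lambda>q. V' q + f q *\<^sub>R W q)"
    using eq by (auto simp: f_def W_def)
  then have "D X V p = D X V' p + D X (\<lambda>q. f q *\<^sub>R W q) p"
    using affine_connection_add[OF D X V(2) fW p] by simp
  also have "D X (\<lambda>q. f q *\<^sub>R W q) p = dir_deriv X f p *\<^sub>R W p + f p *\<^sub>R D X W p"
    by (rule affine_connection_scaleR[OF D X W f p])
  also have "\<dots> = 0" using p eq by (simp add: f_def W_def)
  finally show ?thesis by simp
qed

text \<open>
  The difference of two Levi-Civita connections is a tensor symmetric in its first two slots and, after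
  lowering an index, antisymmetric in the last two; such a tensor vanishes.
\<close>

lemma levi_civita_unique:
  assumes D: "is_levi_civita U g D" and D': "is_levi_civita U g D'"
    and X: "smooth_on U X" and Y: "smooth_on U Y" and p: "p \<in> U"
  shows "D X Y p = D' X Y p"
proof -
  define T where "T A B = D A B p - D' A B p" for A B
  have g: "bilinear (g p)" "\<And>v w. g p v w = g p w v" "nondegenerate_on UNIV (g p)"
    using levi_civita_metric[OF D] p unfolding semi_riemannian_metric_def by simp_all
  have T_sym: "T A B = T B A" if "smooth_on U A" "smooth_on U B" for A B
    using levi_civita_torsion_free[OF D that p] levi_civita_torsion_free[OF D' that p]
    by (simp add: T_def algebra_simps)
  have T_skew: "g p (T A B) (C p) = - g p (T A C) (B p)"
    if "smooth_on U A" "smooth_on U B" "smooth_on U C" for A B C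
    using levi_civita_compatible[OF D that p] levi_civita_compatible[OF D' that p]
    by (simp add: T_def bilinear_lsub[OF g(1)] g(2)[of "B p"])
  have "g p (T X Y) z = 0" for z
  proof -
    \<comment> \<open>Nondegeneracy tests against vectors, while the symmetries concern fields; a
      constant field supplies each test vector.\<close>
    define Z where "Z = (\<lambda>q::'a. z)"
    have Z: "smooth_on U Z" by (simp add: Z_def smooth_on_const)
    have "g p (T X Y) (Z p) = - g p (T X Z) (Y p)" by (rule T_skew[OF X Y Z])
    also have "\<dots> = - g p (T Z X) (Y p)" by (simp add: T_sym[OF X Z])
    also have "\<dots> = g p (T Z Y) (X p)" by (simp add: T_skew[OF Z X Y])
    also have "\<dots> = g p (T Y Z) (X p)" by (simp add: T_sym[OF Y Z])
    also have "\<dots> = - g p (T Y X) (Z p)" by (rule T_skew[OF Y Z X])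
    also have "\<dots> = - g p (T X Y) (Z p)" by (simp add: T_sym[OF X Y])
    finally show ?thesis by (simp add: Z_def)
  qed
  then have "T X Y = 0" using g(3) by (simp add: nondegenerate_on_def)
  then show ?thesis by (simp add: T_def)
qed

text \<open>In the iterated derivatives the inner fields \<open>D B Z\<close> and
  \<open>D' B Z\<close> are known to agree only on \<open>U\<close>, so pointwise uniqueness has to
  be combined with the locality of \<open>affine_connection_cong\<close>.\<close>

lemma curvature_levi_civita_unique:
  assumes D: "is_levi_civita U g D" and D': "is_levi_civita U g D'"
    and X: "smooth_on U X" and Y: "smooth_on U Y" and Z: "smooth_on U Z" and p: "p \<in> U"
  shows "curvature D X Y Z p = curvature D' X Y Z p"
proof -
  have U: "open U"
    using levi_civita_metric[OF D] by (simp add: semi_riemannian_metric_def)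
  note aff = levi_civita_affine[OF D] levi_civita_affine[OF D']
  have twice: "D A (D B Z) p = D' A (D' B Z) p" if "smooth_on U A" "smooth_on U B" for A B
  proof -
    note BZ = affine_connection_smooth[OF aff(1) that(2) Z] affine_connection_smooth[OF aff(2) that(2) Z]
    have "D A (D B Z) p = D' A (D B Z) p"
      by (rule levi_civita_unique[OF D D' that(1) BZ(1) p])
    also have "\<dots> = D' A (D' B Z) p"
      by (rule affine_connection_cong[OF aff(2) U that(1) BZ levi_civita_unique[OF D D' that(2) Z] p])
    finally show ?thesis .
  qed
  have "D (lie_bracket X Y) Z p = D' (lie_bracket X Y) Z p"
    by (rule levi_civita_unique[OF D D' smooth_on_lie_bracket[OF U X Y] Z p])
  then show ?thesis by (simp add: curvature_def twice X Y)
qed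

section \<open>Matrix inversion\<close>

lemma bounded_bilinear_matrix_mult:
  "bounded_bilinear (\<lambda>(A::real^'n^'m) (B::real^'p^'n). A ** B)"
  unfolding bilinear_conv_bounded_bilinear[symmetric] bilinear_def
  by (auto intro!: linearI sum.cong simp: matrix_matrix_mult_def vec_eq_iff
      sum.distrib[symmetric] distrib_left distrib_right sum_distrib_left mult.left_commute mult.assoc)

lemmas has_derivative_matrix_mult = bounded_bilinear.FDERIV[OF bounded_bilinear_matrix_mult]
lemmas smooth_on_matrix_mult = smooth_on_bounded_bilinear[OF bounded_bilinear_matrix_mult]

lemmas matrix_mult_linear =
  bounded_bilinear.add_left[OF bounded_bilinear_matrix_mult]
  bounded_bilinear.add_right[OF bounded_bilinear_matrix_mult]
  bounded_bilinear.diff_left[OF bounded_bilinear_matrix_mult]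
  bounded_bilinear.diff_right[OF bounded_bilinear_matrix_mult]
  bounded_bilinear.minus_left[OF bounded_bilinear_matrix_mult]
  bounded_bilinear.minus_right[OF bounded_bilinear_matrix_mult]
  bounded_bilinear.scaleR_left[OF bounded_bilinear_matrix_mult]
  bounded_bilinear.scaleR_right[OF bounded_bilinear_matrix_mult]

lemma bounded_linear_trace: "bounded_linear (trace :: real^'n^'n \<Rightarrow> real)"
  unfolding linear_conv_bounded_linear[symmetric]
  by (rule linearI) (simp_all add: trace_def sum.distrib sum_distrib_left)

lemma trace_linear:
  fixes A B :: "real^'n^'n"
  shows "trace (A + B) = trace A + trace B" "trace (A - B) = trace A - trace B"
    "trace (- A) = - trace A" "trace (c *\<^sub>R A) = c * trace A"
proof -
  interpret bounded_linear "trace :: real^'n^'n \<Rightarrow> real" by (rule bounded_linear_trace)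
  show "trace (A + B) = trace A + trace B" "trace (A - B) = trace A - trace B"
    "trace (- A) = - trace A" "trace (c *\<^sub>R A) = c * trace A"
    by (simp_all add: add diff neg scaleR)
qed

text \<open>The last two equations are cancellations inside left-nested products, the normal form
  that \<open>matrix_mul_assoc\<close> produces.\<close>

lemma matrix_inv_GL:
  assumes "A \<in> GL"
  shows "A ** matrix_inv A = mat 1" "matrix_inv A ** A = mat 1"
    "B ** A ** matrix_inv A = B" "B ** matrix_inv A ** A = B"
proof -
  have "\<exists>B. A ** B = mat 1 \<and> B ** A = mat 1"
    using assms by (simp add: GL_def invertible_def)
  then have "A ** matrix_inv A = mat 1 \<and> matrix_inv A ** A = mat 1"
    unfolding matrix_inv_def by (rule someI_ex)
  then show "A ** matrix_inv A = mat 1" "matrix_inv A ** A = mat 1"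
    "B ** A ** matrix_inv A = B" "B ** matrix_inv A ** A = B"
    by (simp_all add: matrix_mul_assoc[symmetric])
qed

lemma differentiable_matrix_componentwise:
  fixes f :: "'a::real_normed_vector \<Rightarrow> real^'n^'m"
  shows "f differentiable (at p) \<longleftrightarrow> (\<forall>i j. (\<lambda>x. f x $ i $ j) differentiable (at p))"
  unfolding differentiable_componentwise_within[of f]
  by (auto simp: Basis_vec_def inner_axis)

text \<open>The Leibniz formula is a signed sum of products of entries, so the sum and product rules
  suffice.\<close>

lemma differentiable_det:
  fixes M :: "'a::real_normed_vector \<Rightarrow> real^'n^'n"
  assumes "\<And>i j. (\<lambda>x. M x $ i $ j) differentiable (at p)"
  shows "(\<lambda>x. det (M x)) differentiable (at p)"
proof -
  have "((\<lambda>x. M x $ i $ j) has_derivative frechet_derivative (\<lambda>x. M x $ i $ j) (at p)) (at p)" for i j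
    using assms frechet_derivative_works by blast
  then have prod: "((\<lambda>x. \<Prod>i\<in>UNIV. M x $ i $ \<sigma> i) has_derivative (\<lambda>y. \<Sum>i\<in>UNIV.
      frechet_derivative (\<lambda>x. M x $ i $ \<sigma> i) (at p) y * (\<Prod>j\<in>UNIV - {i}. M p $ j $ \<sigma> j))) (at p)" for \<sigma>
    by (intro has_derivative_prod)
  show ?thesis
    unfolding det_def differentiable_def
    by (rule exI, rule has_derivative_sum[OF has_derivative_mult_right[OF prod]])
qed

lemma differentiable_entry: "(\<lambda>x::real^'n^'m. x $ i $ j) differentiable (at p)"
  using differentiable_matrix_componentwise[of "\<lambda>x. x" p] by simp

lemma GL_det: "GL = {A :: real^'n^'n. det A \<noteq> 0}"
  by (simp add: GL_def invertible_det_nz)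

lemma open_GL: "open (GL :: (real^'n^'n) set)"
proof -
  have "continuous_on UNIV (det :: real^'n^'n \<Rightarrow> real)"
    by (intro continuous_at_imp_continuous_on ballI differentiable_imp_continuous_within
        differentiable_det differentiable_entry)
  then show ?thesis
    unfolding GL_det by (intro open_Collect_neq) auto
qed

text \<open>Column \<open>j\<close> of the inverse solves \<open>A *v x = axis j 1\<close>, to which
  Cramer's rule applies. Writing the entries as quotients of determinants is what makes the inverse
  differentiable.\<close>

lemma matrix_inv_cramer:
  fixes A :: "real^'n^'n"
  assumes "A \<in> GL"
  shows "matrix_inv A $ i $ j =
    det ((\<chi> r c. if c = i then axis j 1 $ r else A $ r $ c) :: real^'n^'n) / det A"
proof -
  have "A *v (matrix_inv A *v axis j 1) = axis j 1"
    by (simp add: matrix_vector_mul_assoc matrix_inv_GL[OF assms])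
  then have "matrix_inv A *v axis j 1 =
      (\<chi> k. det ((\<chi> r c. if c = k then axis j 1 $ r else A $ r $ c) :: real^'n^'n) / det A)"
    using cramer[of A] assms by (simp add: GL_det)
  then have "(matrix_inv A *v axis j 1) $ i =
      det ((\<chi> r c. if c = i then axis j 1 $ r else A $ r $ c) :: real^'n^'n) / det A"
    by simp
  then show ?thesis by (simp add: matrix_vector_mul_component cart_eq_inner_axis[symmetric])
qed

lemma differentiable_transform_open:
  assumes "f differentiable (at p)" "open U" "p \<in> U" "\<And>q. q \<in> U \<Longrightarrow> f q = g q"
  shows "g differentiable (at p)"
proof -
  obtain D where "(f has_derivative D) (at p)"
    using assms(1) by (auto simp: differentiable_def)
  from has_derivative_transform_within_open[OF this assms(2-4)]
  show ?thesis by (auto simp: differentiable_def)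
qed

text \<open>Cramer's formula yields only the existence of a derivative \<open>D\<close>.
  Differentiating \<open>A ** matrix_inv A = mat 1\<close> and multiplying by the inverse on the
  left then determines \<open>D\<close>.\<close>

lemma has_derivative_matrix_inv:
  fixes p :: "real^'n^'n"
  assumes p: "p \<in> GL"
  shows "(matrix_inv has_derivative (\<lambda>v. - (matrix_inv p ** v ** matrix_inv p))) (at p)"
proof -
  have "(\<lambda>A. matrix_inv A $ i $ j) differentiable (at p)" for i j
  proof (rule differentiable_transform_open[OF _ open_GL p])
    have entry: "(\<lambda>A::real^'n^'n. (\<chi> r c. if c = i then axis j 1 $ r else A $ r $ c) $ r $ c)
      differentiable (at p)" for r c
      by (cases "c = i") (simp_all add: differentiable_entry)
    have "det p \<noteq> 0" using p by (simp add: GL_det)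
    show "(\<lambda>A. det ((\<chi> r c. if c = i then axis j 1 $ r else A $ r $ c) :: real^'n^'n) / det A)
      differentiable (at p)"
      by (rule differentiable_divide, rule differentiable_det, rule entry,
          rule differentiable_det, rule differentiable_entry, fact)
  qed (rule matrix_inv_cramer[symmetric])
  then have "matrix_inv differentiable (at p)"
    by (simp add: differentiable_matrix_componentwise)
  then obtain D where D: "(matrix_inv has_derivative D) (at p)"
    using differentiable_def by blast
  have "((\<lambda>A. A ** matrix_inv A) has_derivative (\<lambda>v. p ** D v + v ** matrix_inv p)) (at p)"
    by (rule has_derivative_matrix_mult[OF has_derivative_ident D])
  then have "((\<lambda>A. mat 1 :: real^'n^'n) has_derivative (\<lambda>v. p ** D v + v ** matrix_inv p)) (at p)"
    by (rule has_derivative_transform_within_open[OF _ open_GL p]) (simp add: matrix_inv_GL)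
  then have "(\<lambda>v. p ** D v + v ** matrix_inv p) = (\<lambda>v. 0)"
    by (rule has_derivative_unique[OF _ has_derivative_const])
  then have "p ** D v + v ** matrix_inv p = 0" for v by (rule fun_cong)
  then have "matrix_inv p ** (p ** D v + v ** matrix_inv p) = 0" for v
    by (simp add: bounded_bilinear.zero_right[OF bounded_bilinear_matrix_mult])
  then have "D v = - (matrix_inv p ** v ** matrix_inv p)" for v
    by (simp add: matrix_mult_linear matrix_mul_assoc matrix_inv_GL[OF p] eq_neg_iff_add_eq_0)
  then have "D = (\<lambda>v. - (matrix_inv p ** v ** matrix_inv p))" by blast
  with D show ?thesis by simp
qed

text \<open>Bootstrapping: the derivative is a polynomial expression in the inverse itself, so each
  order of differentiability gives the next one.\<close>

lemma smooth_on_matrix_inv: "smooth_on GL (matrix_inv :: real^'n^'n \<Rightarrow> real^'n^'n)"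
proof -
  have "Ck_on k GL (matrix_inv :: real^'n^'n \<Rightarrow> real^'n^'n)" for k
  proof (induction k)
    case 0
    show ?case
      unfolding Ck_on.simps
      by (rule continuous_at_imp_continuous_on, rule ballI,
          rule has_derivative_continuous[OF has_derivative_matrix_inv])
  next
    case (Suc k)
    have "Ck_on k GL (\<lambda>p. matrix_inv p ** v ** matrix_inv p)" for v :: "real^'n^'n"
      by (rule Ck_on_bounded_bilinear[OF bounded_bilinear_matrix_mult open_GL
            Ck_on_bounded_bilinear[OF bounded_bilinear_matrix_mult open_GL Suc Ck_on_const] Suc])
    note deriv = Ck_on_bounded_linear[OF bounded_linear_minus[OF bounded_linear_ident] open_GL this]
    show ?case
      by (rule Ck_on_SucI[OF open_GL has_derivative_matrix_inv deriv])
  qed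
  then show ?thesis by (simp add: smooth_on_def)
qed

section \<open>Invariance of the index and the trace metric on the general linear group\<close>

lemma index_form_image_subset:
  fixes f :: "'a::euclidean_space \<Rightarrow> 'a"
  assumes "linear f" "inj f" "\<And>v w. c (f v) (f w) = b v w"
  shows "dim ` {S. subspace S \<and> (\<forall>v\<in>S. v \<noteq> 0 \<longrightarrow> b v v < (0::real))}
    \<subseteq> dim ` {S. subspace S \<and> (\<forall>v\<in>S. v \<noteq> 0 \<longrightarrow> c v v < (0::real))}"
proof
  fix n assume "n \<in> dim ` {S. subspace S \<and> (\<forall>v\<in>S. v \<noteq> 0 \<longrightarrow> b v v < 0)}"
  then obtain S where S: "n = dim S" "subspace S" "\<And>v. v \<in> S \<Longrightarrow> v \<noteq> 0 \<Longrightarrow> b v v < 0"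
    by auto
  have "c v v < 0" if v: "v \<in> f ` S" "v \<noteq> 0" for v
  proof -
    obtain s where s: "s \<in> S" "v = f s" using v by blast
    have "s \<noteq> 0" using s v linear_0[OF assms(1)] by auto
    then show ?thesis using s S(3) assms(3) by simp
  qed
  moreover have "dim (f ` S) = n"
    using S(1) assms(1,2) by (simp add: dim_image_eq inj_on_subset)
  moreover have "subspace (f ` S)"
    using assms(1) S(2) by (rule linear_subspace_image)
  ultimately show "n \<in> dim ` {S. subspace S \<and> (\<forall>v\<in>S. v \<noteq> 0 \<longrightarrow> c v v < 0)}"
    by blast
qed

text \<open>An isometric isomorphism carries negative definite subspaces to negative definite
  subspaces of equal dimension, and so does its inverse. The two sets of dimensions under
  \<open>Max\<close> therefore coincide.\<close>

lemma index_form_invariant: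
  fixes f :: "'a::euclidean_space \<Rightarrow> 'a"
  assumes "linear f" "linear f'" "\<And>v. f (f' v) = v" "\<And>v. f' (f v) = v"
    "\<And>v w. c (f v) (f w) = b v w"
  shows "index_form c = index_form b"
proof -
  have inj: "inj f" "inj f'" using assms(3,4) by (metis injI)+
  have inv: "b (f' v) (f' w) = c v w" for v w
    using assms(5)[of "f' v" "f' w"] by (simp add: assms(3))
  show ?thesis
    unfolding index_form_def
    by (rule arg_cong[where f=Max], rule subset_antisym)
      (rule index_form_image_subset[of f' b c, OF assms(2) inj(2) inv]
        index_form_image_subset[of f c b, OF assms(1) inj(1) assms(5)])+
qed

lemma linear_matrix_mult: "linear (\<lambda>V::real^'p^'n. (A::real^'n^'m) ** V)"
  by (rule linearI) (simp_all add: matrix_mult_linear)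

section \<open>The Levi-Civita connection of the general linear group\<close>

lemma bilinear_gl_metric: "bilinear (gl_metric p)"
  unfolding bilinear_def gl_metric_def
  by (auto intro!: linearI simp: matrix_mult_linear trace_linear)

lemma gl_metric_sym: "gl_metric p v w = gl_metric p w v"
  unfolding gl_metric_def
  using trace_mul_sym[of "matrix_inv p ** v" "matrix_inv p ** w"] by (simp add: matrix_mul_assoc)

text \<open>This trace is the sum of the squares of all entries.\<close>

lemma trace_mult_transpose_eq_0:
  fixes A :: "real^'n^'n"
  assumes "trace (A ** transpose A) = 0"
  shows "A = 0"
proof -
  have "(\<Sum>i\<in>UNIV. \<Sum>k\<in>UNIV. (A $ i $ k)\<^sup>2) = 0"
    using assms by (simp add: trace_def matrix_matrix_mult_def transpose_def power2_eq_square)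
  then have "(A $ i $ k)\<^sup>2 = 0" for i k
    by (simp add: sum_nonneg_eq_0_iff sum_nonneg)
  then show ?thesis by (simp add: vec_eq_iff)
qed

lemma nondegenerate_gl_metric:
  assumes "p \<in> GL"
  shows "nondegenerate_on UNIV (gl_metric p)"
  unfolding nondegenerate_on_def
proof (intro ballI impI)
  fix v assume *: "\<forall>w\<in>UNIV. gl_metric p v w = 0"
  \<comment> \<open>The test vector is chosen so that its pairing with \<open>v\<close> becomes the
    sum of the squared entries of \<open>matrix_inv p ** v\<close>.\<close>
  have "trace ((matrix_inv p ** v) ** transpose (matrix_inv p ** v)) = 0"
    using *[THEN bspec, of "p ** transpose (matrix_inv p ** v)"]
    by (simp add: gl_metric_def matrix_mul_assoc matrix_inv_GL[OF assms])
  then have "matrix_inv p ** v = 0" by (rule trace_mult_transpose_eq_0)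
  then have "p ** (matrix_inv p ** v) = 0"
    by (simp add: bounded_bilinear.zero_right[OF bounded_bilinear_matrix_mult])
  then show "v = 0" by (simp add: matrix_mul_assoc matrix_inv_GL[OF assms])
qed

lemma semi_riemannian_gl_metric:
  "semi_riemannian_metric GL (gl_metric :: real^'n^'n \<Rightarrow> real^'n^'n \<Rightarrow> real^'n^'n \<Rightarrow> real)"
  unfolding semi_riemannian_metric_def
proof (intro conjI ballI allI)
  fix v w :: "real^'n^'n"
  show "smooth_on GL (\<lambda>p. gl_metric p v w)"
    unfolding gl_metric_def
    by (intro smooth_on_bounded_linear[OF bounded_linear_trace] smooth_on_matrix_mult open_GL
        smooth_on_matrix_inv smooth_on_const)
next
  \<comment> \<open>Left multiplication by \<open>p\<close> is an isometry from the tangent space at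
    the identity to the one at \<open>p\<close>, so the index everywhere is that at the
    identity.\<close>
  have "index_form (gl_metric p) = index_form (gl_metric (mat 1 :: real^'n^'n))"
    if p: "p \<in> GL" for p :: "real^'n^'n"
  proof (rule index_form_invariant[OF linear_matrix_mult linear_matrix_mult, of p "matrix_inv p"])
    have "(mat 1 :: real^'n^'n) \<in> GL" by (simp add: GL_det)
    then have "matrix_inv (mat 1 :: real^'n^'n) = mat 1"
      using matrix_inv_GL(1) by force
    then show "gl_metric p (p ** v) (p ** w) = gl_metric (mat 1) v w" for v w
      by (simp add: gl_metric_def matrix_mul_assoc matrix_inv_GL[OF p])
  qed (simp_all add: matrix_mul_assoc matrix_inv_GL[OF p])
  then show "\<exists>\<nu>. \<forall>p\<in>(GL :: (real^'n^'n) set). index_form (gl_metric p) = \<nu>" by blast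
qed (simp_all add: open_GL bilinear_gl_metric gl_metric_sym nondegenerate_gl_metric)

text \<open>
  The quadratic term is the one for which the geodesics are the curves \<open>A exp (tV)\<close>, that is,
  \<open>c'' = c' c\<^sup>-\<^sup>1 c'\<close>.
\<close>

definition gl_connection ::
    "(real^'n^'n \<Rightarrow> real^'n^'n) \<Rightarrow> (real^'n^'n \<Rightarrow> real^'n^'n) \<Rightarrow> real^'n^'n \<Rightarrow> real^'n^'n" where
  "gl_connection X Y p = dir_deriv X Y p
     - (1/2) *\<^sub>R (X p ** matrix_inv p ** Y p + Y p ** matrix_inv p ** X p)"

lemma dir_derivI: "(f has_derivative f') (at p) \<Longrightarrow> dir_deriv X f p = f' (X p)"
  by (simp add: dir_deriv_def frechet_derivativeI)

lemma smooth_on_gl_connection: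
  "smooth_on GL X \<Longrightarrow> smooth_on GL Y \<Longrightarrow> smooth_on GL (gl_connection X Y)"
  unfolding gl_connection_def[abs_def]
  by (intro smooth_on_diff smooth_on_dir_deriv smooth_on_scaleR_const smooth_on_add
      smooth_on_matrix_mult smooth_on_matrix_inv open_GL)

text \<open>The quadratic term is linear over functions in both fields, so the Leibniz term comes
  from \<open>dir_deriv\<close> alone.\<close>

lemma affine_gl_connection: "affine_connection GL gl_connection"
  unfolding affine_connection_def
proof (intro conjI allI impI ballI)
  fix X Y :: "real^'n^'n \<Rightarrow> real^'n^'n"
  assume XY: "smooth_on GL X" "smooth_on GL Y"
  show "smooth_on GL (gl_connection X Y)" using XY by (rule smooth_on_gl_connection)
next
  fix X X' Y :: "real^'n^'n \<Rightarrow> real^'n^'n" and p :: "real^'n^'n"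
  assume "smooth_on GL Y" and p: "p \<in> GL"
  then have "linear (frechet_derivative Y (at p))"
    by (intro linear_frechet_derivative smooth_on_differentiable)
  then show "gl_connection (\<lambda>q. X q + X' q) Y p = gl_connection X Y p + gl_connection X' Y p"
    by (simp add: gl_connection_def dir_deriv_def linear_add matrix_mult_linear algebra_simps)
next
  fix f and X Y :: "real^'n^'n \<Rightarrow> real^'n^'n" and p :: "real^'n^'n"
  assume "smooth_on GL Y" and p: "p \<in> GL"
  then have "linear (frechet_derivative Y (at p))"
    by (intro linear_frechet_derivative smooth_on_differentiable)
  then show "gl_connection (\<lambda>q. f q *\<^sub>R X q) Y p = f p *\<^sub>R gl_connection X Y p"
    by (simp add: gl_connection_def dir_deriv_def linear_scale matrix_mult_linear algebra_simps)
next
  fix X Y Y' :: "real^'n^'n \<Rightarrow> real^'n^'n" and p :: "real^'n^'n"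
  assume "smooth_on GL Y" "smooth_on GL Y'" and p: "p \<in> GL"
  then have "dir_deriv X (\<lambda>q. Y q + Y' q) p = dir_deriv X Y p + dir_deriv X Y' p"
    unfolding dir_deriv_def[of X Y] dir_deriv_def[of X Y']
    by (intro dir_derivI has_derivative_add smooth_on_has_derivative)
  then show "gl_connection X (\<lambda>q. Y q + Y' q) p = gl_connection X Y p + gl_connection X Y' p"
    by (simp add: gl_connection_def matrix_mult_linear algebra_simps)
next
  fix f :: "real^'n^'n \<Rightarrow> real" and X Y :: "real^'n^'n \<Rightarrow> real^'n^'n" and p :: "real^'n^'n"
  assume f: "smooth_on GL f" and Y: "smooth_on GL Y" and p: "p \<in> GL"
  have "dir_deriv X (\<lambda>q. f q *\<^sub>R Y q) p = f p *\<^sub>R dir_deriv X Y p + dir_deriv X f p *\<^sub>R Y p"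
    unfolding dir_deriv_def[of X Y] dir_deriv_def[of X f]
    by (rule dir_derivI[OF has_derivative_scaleR[OF smooth_on_has_derivative[OF f p]
            smooth_on_has_derivative[OF Y p]]])
  then show "gl_connection X (\<lambda>q. f q *\<^sub>R Y q) p
      = dir_deriv X f p *\<^sub>R Y p + f p *\<^sub>R gl_connection X Y p"
    by (simp add: gl_connection_def matrix_mult_linear algebra_simps)
qed

lemma gl_connection_compatible:
  fixes X Y Z :: "real^'n^'n \<Rightarrow> real^'n^'n"
  assumes Y: "smooth_on GL Y" and Z: "smooth_on GL Z" and p: "p \<in> GL"
  shows "dir_deriv X (\<lambda>q. gl_metric q (Y q) (Z q)) p =
    gl_metric p (gl_connection X Y p) (Z p) + gl_metric p (Y p) (gl_connection X Z p)"
proof -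
  let ?i = "matrix_inv p"
  note inv = has_derivative_matrix_inv[OF p]
  note dY = smooth_on_has_derivative[OF Y p] and dZ = smooth_on_has_derivative[OF Z p]
  note deriv = bounded_linear.has_derivative[OF bounded_linear_trace
      has_derivative_matrix_mult[OF has_derivative_matrix_mult[OF
          has_derivative_matrix_mult[OF inv dY] inv] dZ]]
  \<comment> \<open>The quadratic terms of the connection produce the cubic traces in the orders
    XYZ, YXZ (twice) and YZX, each with factor -1/2. Identifying YZX with XYZ leaves one copy each
    of XYZ and YXZ, matching the two derivatives of the inverse.\<close>
  have cyc: "trace (?i ** Y p ** ?i ** Z p ** ?i ** X p) = trace (?i ** X p ** ?i ** Y p ** ?i ** Z p)"
    using trace_mul_sym[of "?i ** Y p ** ?i ** Z p" "?i ** X p"] by (simp add: matrix_mul_assoc)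
  show ?thesis
    unfolding gl_metric_def
    by (subst dir_derivI[OF deriv])
      (simp add: gl_connection_def dir_deriv_def matrix_mult_linear matrix_mul_assoc trace_linear cyc,
       simp add: field_simps)
qed

lemma levi_civita_gl_connection: "is_levi_civita GL gl_metric gl_connection"
  unfolding is_levi_civita_def
  by (auto simp: semi_riemannian_gl_metric affine_gl_connection gl_connection_compatible
      lie_bracket_def gl_connection_def add.commute)

section \<open>Curvature\<close>

text \<open>Differentiates the inner field of an iterated covariant derivative. Each triple product
  yields three terms; the negative one comes from its middle factor, the inverse.\<close>

lemma has_derivative_gl_connection:
  fixes Y Z :: "real^'n^'n \<Rightarrow> real^'n^'n"
  assumes Y: "smooth_on GL Y" and Z: "smooth_on GL Z" and p: "p \<in> GL"
  shows "(gl_connection Y Z has_derivative (\<lambda>h.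
      frechet_derivative (\<lambda>q. frechet_derivative Z (at q) (Y p)) (at p) h
      + frechet_derivative Z (at p) (frechet_derivative Y (at p) h)
      - (1/2) *\<^sub>R (frechet_derivative Y (at p) h ** matrix_inv p ** Z p
          - Y p ** matrix_inv p ** h ** matrix_inv p ** Z p
          + Y p ** matrix_inv p ** frechet_derivative Z (at p) h
          + frechet_derivative Z (at p) h ** matrix_inv p ** Y p
          - Z p ** matrix_inv p ** h ** matrix_inv p ** Y p
          + Z p ** matrix_inv p ** frechet_derivative Y (at p) h))) (at p)"
proof -
  note inv = has_derivative_matrix_inv[OF p]
  note dY = smooth_on_has_derivative[OF Y p] and dZ = smooth_on_has_derivative[OF Z p]
  note triple = has_derivative_matrix_mult[OF has_derivative_matrix_mult[OF _ inv]]
  show ?thesis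
    unfolding gl_connection_def[abs_def]
    by (rule has_derivative_eq_rhs,
        rule has_derivative_diff[OF has_derivative_dir_deriv[OF Z dY open_GL p]
          has_derivative_scaleR_right[OF has_derivative_add[OF triple[OF dY dZ] triple[OF dZ dY]]]])
      (simp add: fun_eq_iff matrix_mult_linear matrix_mul_assoc algebra_simps)
qed

lemma curvature_gl_connection:
  fixes X Y Z :: "real^'n^'n \<Rightarrow> real^'n^'n"
  assumes X: "smooth_on GL X" and Y: "smooth_on GL Y" and Z: "smooth_on GL Z" and p: "p \<in> GL"
  shows "curvature gl_connection X Y Z p = (- (1/4)) *\<^sub>R
    (Z p ** commutator (matrix_inv p ** X p) (matrix_inv p ** Y p)
     - commutator (X p ** matrix_inv p) (Y p ** matrix_inv p) ** Z p)"
proof -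
  define i x y z where "i = matrix_inv p" and "x = X p" and "y = Y p" and "z = Z p"
  define dX dY dZ where "dX = frechet_derivative X (at p)"
    and "dY = frechet_derivative Y (at p)" and "dZ = frechet_derivative Z (at p)"
  define B where "B v = frechet_derivative (\<lambda>q. frechet_derivative Z (at q) v) (at p)" for v
  have B: "B y x = B x y"
    unfolding B_def by (rule symmetric_second_derivative[OF open_GL Z p])
  have dZ: "dZ (a - b) = dZ a - dZ b" for a b
    using linear_frechet_derivative[OF smooth_on_differentiable[OF Z p]]
    by (simp add: dZ_def linear_diff)
  note defs = i_def[symmetric] x_def[symmetric] y_def[symmetric] z_def[symmetric]
    dX_def[symmetric] dY_def[symmetric] dZ_def[symmetric] B_def[symmetric]
  have bracket: "gl_connection (lie_bracket X Y) Z p = dZ (dY x) - dZ (dX y)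
      - (1/2) *\<^sub>R ((dY x - dX y) ** i ** z + z ** i ** (dY x - dX y))"
    by (simp add: gl_connection_def lie_bracket_def dir_deriv_def defs dZ)
  have single: "gl_connection Y Z p = dZ y - (1/2) *\<^sub>R (y ** i ** z + z ** i ** y)"
    "gl_connection X Z p = dZ x - (1/2) *\<^sub>R (x ** i ** z + z ** i ** x)"
    by (simp_all add: gl_connection_def dir_deriv_def defs)
  have XY: "gl_connection X (gl_connection Y Z) p =
      B y x + dZ (dY x) - (1/2) *\<^sub>R (dY x ** i ** z - y ** i ** x ** i ** z + y ** i ** dZ x
          + dZ x ** i ** y - z ** i ** x ** i ** y + z ** i ** dY x)
      - (1/2) *\<^sub>R (x ** i ** gl_connection Y Z p + gl_connection Y Z p ** i ** x)"
    unfolding gl_connection_def[of X "gl_connection Y Z"]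
      dir_derivI[OF has_derivative_gl_connection[OF Y Z p]]
    by (simp only: defs)
  have YX: "gl_connection Y (gl_connection X Z) p =
      B x y + dZ (dX y) - (1/2) *\<^sub>R (dX y ** i ** z - x ** i ** y ** i ** z + x ** i ** dZ y
          + dZ y ** i ** x - z ** i ** y ** i ** x + z ** i ** dX y)
      - (1/2) *\<^sub>R (y ** i ** gl_connection X Z p + gl_connection X Z p ** i ** y)"
    unfolding gl_connection_def[of Y "gl_connection X Z"]
      dir_derivI[OF has_derivative_gl_connection[OF X Z p]]
    by (simp only: defs)
  \<comment> \<open>What remains is algebra in noncommuting letters. Differentiating the inverse
    contributes the cubic words with coefficient 1/2, the nested quadratic terms contribute them
    with coefficient 1/4 and opposite sign; the difference is the 1/4 of the result, while the words
    with \<open>z\<close> in the middle cancel.\<close>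
  show ?thesis
    unfolding curvature_def bracket XY YX single B commutator_def defs
    by (simp add: matrix_mult_linear matrix_mul_assoc scaleR_add_right scaleR_diff_right)
qed

text \<open>The connection picked by \<open>SOME\<close> is known only to be a Levi-Civita
  connection; uniqueness transfers the explicit formula to its curvature.\<close>

lemma curvature_gl:
  fixes X Y Z :: "real^'n^'n \<Rightarrow> real^'n^'n"
  assumes "smooth_on GL X" "smooth_on GL Y" "smooth_on GL Z" "p \<in> GL"
  shows "curvature (levi_civita GL gl_metric) X Y Z p = (- (1/4)) *\<^sub>R
    (Z p ** commutator (matrix_inv p ** X p) (matrix_inv p ** Y p)
     - commutator (X p ** matrix_inv p) (Y p ** matrix_inv p) ** Z p)"
proof -
  have "is_levi_civita GL gl_metric (levi_civita GL (gl_metric :: real^'n^'n \<Rightarrow> _))"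
    unfolding levi_civita_def
    by (rule someI[of "is_levi_civita GL gl_metric", OF levi_civita_gl_connection])
  from curvature_levi_civita_unique[OF this levi_civita_gl_connection assms]
  show ?thesis by (simp add: curvature_gl_connection[OF assms])
qed

lemma riemann13_gl:
  fixes K :: "real^'n^'n"
  assumes K: "K \<in> GL"
  shows "riemann13 GL gl_metric K x y z = (- (1/4)) *\<^sub>R
    (z ** commutator (matrix_inv K ** x) (matrix_inv K ** y)
     - commutator (x ** matrix_inv K) (y ** matrix_inv K) ** z)"
    (is "_ = ?R")
  unfolding riemann13_def
proof (rule the_equality)
  show "\<forall>X Y Z. smooth_on GL X \<longrightarrow> smooth_on GL Y \<longrightarrow> smooth_on GL Z \<longrightarrow>
      X K = x \<longrightarrow> Y K = y \<longrightarrow> Z K = z \<longrightarrow> curvature (levi_civita GL gl_metric) X Y Z K = ?R"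
    using curvature_gl[OF _ _ _ K] by blast
next
  fix w
  assume "\<forall>X Y Z. smooth_on GL X \<longrightarrow> smooth_on GL Y \<longrightarrow> smooth_on GL Z \<longrightarrow>
      X K = x \<longrightarrow> Y K = y \<longrightarrow> Z K = z \<longrightarrow> curvature (levi_civita GL gl_metric) X Y Z K = w"
  \<comment> \<open>Constant extensions show that the description ranges over at least one triple of
    fields, which pins down \<open>w\<close>.\<close>
  from this[rule_format, of "\<lambda>_. x" "\<lambda>_. y" "\<lambda>_. z"]
  show "w = ?R"
    using curvature_gl[OF smooth_on_const smooth_on_const smooth_on_const K, of x y z]
    by (simp add: smooth_on_const)
qed

lemma riemann04_gl:
  fixes K :: "real^'n^'n"
  assumes K: "K \<in> GL"
  shows "riemann04 GL gl_metric K x y z w =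
    1/4 * trace (commutator (matrix_inv K ** x) (matrix_inv K ** y)
                 ** commutator (matrix_inv K ** z) (matrix_inv K ** w))"
proof -
  define i where "i = matrix_inv K"
  define C where "C = commutator (i ** x) (i ** y)"
  \<comment> \<open>Conjugation by \<open>K\<close> exchanges the two kinds of commutator, so the
    (0,4) tensor can be expressed through \<open>C\<close> alone.\<close>
  have C: "i ** commutator (x ** i) (y ** i) = C ** i"
    by (simp add: C_def commutator_def matrix_mult_linear matrix_mul_assoc)
  have "i ** commutator (x ** i) (y ** i) ** z ** i ** w = C ** i ** z ** i ** w"
    by (simp add: C)
  then have "riemann04 GL gl_metric K x y z w =
      - (1/4) * (trace (i ** z ** C ** i ** w) - trace (C ** i ** z ** i ** w))"
    unfolding riemann04_def riemann13_gl[OF K] gl_metric_def i_def[symmetric] C_def[symmetric]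
    by (simp add: matrix_mult_linear trace_linear matrix_mul_assoc)
  also have "trace (i ** z ** C ** i ** w) = trace (C ** i ** w ** i ** z)"
    using trace_mul_sym[of "i ** z" "C ** i ** w"] by (simp add: matrix_mul_assoc)
  also have "- (1/4) * (trace (C ** i ** w ** i ** z) - trace (C ** i ** z ** i ** w)) =
      1/4 * trace (C ** commutator (i ** z) (i ** w))"
    by (simp add: commutator_def matrix_mult_linear trace_linear matrix_mul_assoc field_simps)
  finally show ?thesis by (simp add: C_def i_def)
qed

section \<open>Bases of a plane and sectional curvature\<close>

lemma lin_indep2_lincomb_eq_0:
  assumes "lin_indep2 x y" "a *\<^sub>R x + b *\<^sub>R y = 0"
  shows "a = 0 \<and> b = 0"
proof -
  have ind: "x \<notin> span {y}" "y \<noteq> 0"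
    using assms(1) by (auto simp: lin_indep2_def independent_insert)
  have "a = 0"
  proof (rule ccontr)
    assume "a \<noteq> 0"
    have "a *\<^sub>R x = (- b) *\<^sub>R y" using assms(2) by (simp add: eq_neg_iff_add_eq_0)
    then have "(1 / a) *\<^sub>R (a *\<^sub>R x) = (1 / a) *\<^sub>R ((- b) *\<^sub>R y)" by simp
    then have "x = (1 / a * - b) *\<^sub>R y" using \<open>a \<noteq> 0\<close> by simp
    then have "x \<in> span {y}" by (metis span_base span_scale insertI1)
    with ind show False by blast
  qed
  with assms(2) ind show ?thesis by simp
qed

text \<open>An independent pair in \<open>S\<close> already has \<open>dim S\<close> elements, so
  its span contains \<open>S\<close>.\<close>

lemma lin_indep2_spans:
  fixes x y :: "'a::euclidean_space"
  assumes "lin_indep2 x y" "dim S = 2" "x \<in> S" "y \<in> S" "v \<in> S"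
  obtains a b where "v = a *\<^sub>R x + b *\<^sub>R y"
proof -
  have "S \<subseteq> span {x, y}"
    using assms by (intro card_ge_dim_independent) (auto simp: lin_indep2_def)
  with assms(5) have "v \<in> span {x, y}" by blast
  then obtain a where "v - a *\<^sub>R x \<in> span {y}"
    unfolding span_breakdown_eq by blast
  then obtain b where "v - a *\<^sub>R x = b *\<^sub>R y" by (auto simp: span_singleton)
  then have "v = a *\<^sub>R x + b *\<^sub>R y" by (simp add: algebra_simps)
  then show ?thesis by (rule that)
qed

text \<open>
  Under a change of basis of the plane, numerator and denominator both scale by the squared
  determinant of the change.
\<close>

lemma sectional_curvature_gl:
  fixes K :: "real^'n^'n"
  assumes K: "K \<in> GL" and S: "nondegenerate_section gl_metric K S"
    and X: "X \<in> S" and Y: "Y \<in> S" and ind: "lin_indep2 X Y"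
  shows "sectional_curvature GL gl_metric K S =
    1/4 * (trace (commutator (matrix_inv K ** X) (matrix_inv K ** Y)
                  ** commutator (matrix_inv K ** X) (matrix_inv K ** Y))
           / (gl_metric K X X * gl_metric K Y Y - (gl_metric K X Y)\<^sup>2))"
proof -
  define g where "g = gl_metric K"
  define C where "C x y = commutator (matrix_inv K ** x) (matrix_inv K ** y)" for x y
  define N where "N x y = trace (C x y ** C x y)" for x y
  define D where "D x y = g x x * g y y - (g x y)\<^sup>2" for x y
  have quot: "N x y / D x y = N X Y / D X Y" if xy: "x \<in> S" "y \<in> S" "lin_indep2 x y" for x y
  proof -
    have dim: "dim S = 2" using S by (simp add: nondegenerate_section_def)
    obtain a b where x: "x = a *\<^sub>R X + b *\<^sub>R Y"
      using lin_indep2_spans[OF ind dim X Y xy(1)] .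
    obtain c d where y: "y = c *\<^sub>R X + d *\<^sub>R Y"
      using lin_indep2_spans[OF ind dim X Y xy(2)] .
    \<comment> \<open>The determinant of the change of basis from \<open>X\<close>, \<open>Y\<close>
      to \<open>x\<close>, \<open>y\<close>.\<close>
    define \<delta> where "\<delta> = a * d - b * c"
    have "\<delta> \<noteq> 0"
    proof
      assume "\<delta> = 0"
      then have ad: "a * d = b * c" by (simp add: \<delta>_def)
      \<comment> \<open>Multiplication by the adjugate of the change of basis. With determinant zero
        these become linear relations between \<open>x\<close> and \<open>y\<close>; independence
        then gives \<open>a = b = 0\<close>, hence \<open>x = 0\<close>.\<close>
      have "d *\<^sub>R x + (- b) *\<^sub>R y = (a * d - b * c) *\<^sub>R X" "(- c) *\<^sub>R x + a *\<^sub>R y = (a * d - b * c) *\<^sub>R Y"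
        by (simp_all add: x y algebra_simps)
      then have "d *\<^sub>R x + (- b) *\<^sub>R y = 0" "(- c) *\<^sub>R x + a *\<^sub>R y = 0"
        by (simp_all add: ad)
      then have "a = 0" "b = 0"
        using lin_indep2_lincomb_eq_0[OF xy(3)] by fastforce+
      then have "1 *\<^sub>R x + 0 *\<^sub>R y = 0" by (simp add: x)
      then show False using lin_indep2_lincomb_eq_0[OF xy(3)] by fastforce
    qed
    \<comment> \<open>\<open>C\<close> is bilinear and alternating, so it scales by the
      determinant.\<close>
    have "C x y = \<delta> *\<^sub>R C X Y"
      by (simp add: C_def commutator_def x y \<delta>_def matrix_mult_linear algebra_simps)
    then have N: "N x y = \<delta>\<^sup>2 * N X Y"
      by (simp add: N_def matrix_mult_linear trace_linear power2_eq_square)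
    have bil: "bilinear g" and sym: "g Y X = g X Y"
      by (simp_all add: g_def bilinear_gl_metric gl_metric_sym)
    \<comment> \<open>\<open>D\<close> is a Gram determinant, hence scales by the square of the
      determinant, as \<open>N\<close> does.\<close>
    have "D x y = \<delta>\<^sup>2 * D X Y"
      by (simp add: D_def x y \<delta>_def bilinear_ladd[OF bil] bilinear_radd[OF bil]
          bilinear_lmul[OF bil] bilinear_rmul[OF bil] sym)
        (simp add: algebra_simps power2_eq_square)
    with N \<open>\<delta> \<noteq> 0\<close> show ?thesis by simp
  qed
  have sec: "riemann04 GL gl_metric K x y x y
      / (gl_metric K x x * gl_metric K y y - (gl_metric K x y)\<^sup>2) = 1/4 * (N x y / D x y)" for x y
    by (simp add: riemann04_gl[OF K] N_def D_def C_def g_def)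
  have "sectional_curvature GL gl_metric K S = 1/4 * (N X Y / D X Y)"
    unfolding sectional_curvature_def sec
  proof (rule the_equality)
    show "\<forall>x\<in>S. \<forall>y\<in>S. lin_indep2 x y \<longrightarrow> 1/4 * (N x y / D x y) = 1/4 * (N X Y / D X Y)"
      using quot by simp
  \<comment> \<open>The pair \<open>X\<close>, \<open>Y\<close> itself is an admissible basis, so
    any common value equals its quotient.\<close>
  qed (use X Y ind in blast)
  then show ?thesis by (simp add: N_def D_def C_def g_def)
qed

theorem proposition3p1:
  fixes K X Y Z W :: "real ^ 'n ^ 'n"
  assumes "K \<in> GL"
  shows "riemann13 GL gl_metric K X Y Z =
           (- (1/4)) *\<^sub>R (Z ** commutator (matrix_inv K ** X) (matrix_inv K ** Y)
                        - commutator (X ** matrix_inv K) (Y ** matrix_inv K) ** Z)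
       \<and> riemann04 GL gl_metric K X Y Z W =
           1/4 * trace (commutator (matrix_inv K ** X) (matrix_inv K ** Y)
                        ** commutator (matrix_inv K ** Z) (matrix_inv K ** W))
       \<and> (\<forall>S. nondegenerate_section gl_metric K S \<longrightarrow> X \<in> S \<longrightarrow> Y \<in> S \<longrightarrow> lin_indep2 X Y \<longrightarrow>
           sectional_curvature GL gl_metric K S =
             1/4 * (trace (commutator (matrix_inv K ** X) (matrix_inv K ** Y)
                           ** commutator (matrix_inv K ** X) (matrix_inv K ** Y))
                    / (gl_metric K X X * gl_metric K Y Y - (gl_metric K X Y)\<^sup>2)))"
  using riemann13_gl[OF assms] riemann04_gl[OF assms] sectional_curvature_gl[OF assms] by blast

end
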